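(* For all complex $t$ with $|t|<1$, $$\sum_{n=1}^{\infty}\left(H_n^-\right)^2 t^n = \frac{1}{1-t}\left\{\operatorname{Li}_2(t) + 2\log 2\,\log(1+t) + 2\operatorname{Li}_2\left(\tfrac{1}{2}\right) - 2\operatorname{Li}_2\left(\tfrac{1+t}{2}\right)\right\},$$ and for all complex $t$ with $|t|\le 1$ (where for $t=1$ the right-hand side is understood as its limit as $t\to 1$), $$\sum_{n=0}^{\infty}\left(H_n^- - \log 2\right)^2 t^n = \frac{1}{1-t}\left\{\operatorname{Li}_2(t) + \log^2 2 - 2\left[\operatorname{Li}_2\left(\tfrac{1+t}{2}\right) - \operatorname{Li}_2\left(\tfrac{1}{2}\right)\right]\right\}.$$
   Context: The skew-harmonic numbers are $H_0^-=0$ and $H_n^- = 1-\frac12+\dots+\frac{(-1)^{n-1}}{n}=\sum_{k=1}^n \frac{(-1)^{k-1}}{k}$ for $n\ge 1$. The dilogarithm is $\operatorname{Li}_2(t)=\sum_{n=1}^\infty \frac{t^n}{n^2}$ for $|t|\le 1$. $\log$ is the principal branch of the natural logarithm; $\log^2 2=(\log 2)^2$. *)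

theory Defs
  imports "HOL-Analysis.Analysis"
begin

definition skew_harm :: "nat \<Rightarrow> real" where
  "skew_harm n = (\<Sum>k=1..n. (-1) ^ (k - 1) / real k)"

(* The series converges exactly for norm t \<le> 1; only those values are meaningful,
   since suminf is unspecified on divergent series. *)
definition dilog :: "complex \<Rightarrow> complex" where
  "dilog t = (\<Sum>n. t ^ Suc n / of_nat (Suc n) ^ 2)"

end

theory Submission
  imports Defs
begin

text \<open>
  Write \<open>d\<^sub>n\<close> for the deviation of the \<open>n\<close>-th skew-harmonic number from its limit \<open>log 2\<close>. The
  formula for \<open>\<Sum> d\<^sub>n\<^sup>2 t\<^sup>n\<close> is summation by parts: multiplying a power series by \<open>1 - t\<close> replaces
  its coefficients by their differences (lemma \<open>sums_difference\<close>), and since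
  \<open>d\<^sub>n - d\<^sub>n\<^sub>-\<^sub>1 = (-1)\<^sup>n\<^sup>-\<^sup>1 / n\<close>, the differences of the squares are
  \<open>1 / n\<^sup>2 + 2 c\<^sub>n\<close> with \<open>c\<^sub>n = (-1)\<^sup>n\<^sup>-\<^sup>1 d\<^sub>n\<^sub>-\<^sub>1 / n\<close>. The squares \<open>1 / n\<^sup>2\<close> give \<open>Li\<^sub>2(t)\<close> and
  the term \<open>d\<^sub>0\<^sup>2\<close> gives \<open>log\<^sup>2 2\<close>.

  What remains is \<open>\<Sum> c\<^sub>n t\<^sup>n = Li\<^sub>2(1/2) - Li\<^sub>2((1 + t)/2)\<close>. Inside the disc the derivative of the
  left-hand side is \<open>\<Sum> d\<^sub>n (-t)\<^sup>n\<close>, which a second summation by parts (\<open>skew_dev_sums\<close>) evaluates to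
  \<open>log((1 - t)/2) / (1 + t)\<close>; this is also the derivative of \<open>- Li\<^sub>2((1 + t)/2)\<close>, because
  \<open>Li\<^sub>2'(z) = - log(1 - z) / z\<close>, and both sides of the identity vanish at
  \<open>t = 0\<close> (\<open>cross_series_ball\<close>).

  The boundary circle is reached by continuity. The Leibniz bound \<open>\<bar>d\<^sub>n\<bar> \<le> 1 / (n + 1)\<close>
  (\<open>norm_skew_dev_le\<close>) makes \<open>c\<^sub>n\<close> and \<open>d\<^sub>n\<^sup>2\<close> of order \<open>1 / n\<^sup>2\<close>, so their power series,
  like that of the dilogarithm, converge uniformly on the closed disc. The same continuity at \<open>t = 1\<close> turns the value of
  \<open>\<Sum> d\<^sub>n\<^sup>2\<close> into the limit of the closed form. Finally, the generating function of the squares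
  of the skew-harmonic numbers themselves follows by expanding \<open>(d\<^sub>n + log 2)\<^sup>2\<close>.
\<close>

section \<open>Skew-harmonic numbers and their distance from the limit\<close>

text \<open>The deviations are taken complex, being used as coefficients of complex power series.\<close>
definition skew_dev :: "nat \<Rightarrow> complex" where
  "skew_dev n = of_real (skew_harm n - ln 2)"

lemma skew_harm_0 [simp]: "skew_harm 0 = 0"
  by (simp add: skew_harm_def)

lemma skew_harm_Suc: "skew_harm (Suc n) = skew_harm n + (-1) ^ n / real (Suc n)"
  by (simp add: skew_harm_def)

lemma skew_harm_eq_partial_sum: "skew_harm n = (\<Sum>k<n. (-1) ^ k * (1 / real (Suc k)))"
  by (induction n) (simp_all add: skew_harm_Suc)

text \<open>The partial sums of an alternating series whose terms decrease to \<open>0\<close> in absolute value lie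
  alternately below and above the limit, so the error of each is at most the next term.\<close>
lemma norm_skew_dev_le: "norm (skew_dev n) \<le> 1 / real (Suc n)"
proof -
  define l where "l = (\<Sum>k. (-1) ^ k * (1 / real (Suc k)))"
  have l: "l = ln 2"
    using alternating_harmonic_series_sums unfolding l_def by (simp add: sums_iff)
  have lim: "(\<lambda>k. 1 / real (Suc k)) \<longlonglongrightarrow> 0"
    using LIMSEQ_inverse_real_of_nat by (simp add: inverse_eq_divide)
  have mono: "monoseq (\<lambda>k. 1 / real (Suc k))"
    by (rule monoI2) (simp add: field_simps)
  have lower: "skew_harm (2 * m) \<le> l" and upper: "l \<le> skew_harm (2 * m + 1)" for m
    using summable_Leibniz(2)[OF lim mono]
    unfolding l_def skew_harm_eq_partial_sum by auto
  have step: "\<bar>skew_harm (Suc n) - skew_harm n\<bar> = 1 / real (Suc n)"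
    by (simp add: skew_harm_Suc abs_divide power_abs)
  have "\<bar>skew_harm n - l\<bar> \<le> \<bar>skew_harm (Suc n) - skew_harm n\<bar>"
  proof (cases "even n")
    case True
    then obtain m where "n = 2 * m" by blast
    then show ?thesis using lower[of m] upper[of m] by simp
  next
    case False
    then obtain m where "n = 2 * m + 1" by (rule oddE)
    then show ?thesis using lower[of "Suc m"] upper[of m] by simp
  qed
  then show ?thesis
    unfolding skew_dev_def norm_of_real step l by simp
qed

section \<open>Power series and summation by parts\<close>

lemma sums_difference:
  fixes t :: "'a :: real_normed_field"
  assumes "(\<lambda>n. a n * t ^ n) sums S"
  shows "(\<lambda>n. (a (Suc n) - a n) * t ^ Suc n) sums ((1 - t) * S - a 0)"
proof -
  have "(\<lambda>n. a (Suc n) * t ^ Suc n) sums (S - a 0)"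
    using assms sums_Suc_iff[of "\<lambda>n. a n * t ^ n" "S - a 0"] by simp
  from sums_diff[OF this sums_mult[OF assms, of t]]
  show ?thesis by (simp add: algebra_simps)
qed

text \<open>Absolute convergence on the unit circle makes the convergence on the closed disc uniform, by
  the Weierstrass test. This is what carries identities from the open disc to its boundary.\<close>
lemma continuous_on_suminf_cball:
  fixes c :: "nat \<Rightarrow> complex"
  assumes "summable (\<lambda>n. norm (c n))"
  shows "continuous_on (cball 0 1) (\<lambda>t. \<Sum>n. c n * t ^ n)"
proof -
  have "uniform_limit (cball 0 1) (\<lambda>n t. \<Sum>i<n. c i * t ^ i) (\<lambda>t. \<Sum>n. c n * t ^ n) sequentially"
  proof (rule Weierstrass_m_test[OF _ assms])
    show "norm (c n * t ^ n) \<le> norm (c n)" if "t \<in> cball 0 1" for n and t :: complex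
      using that by (simp add: norm_mult norm_power power_le_one mult_left_le)
  qed
  then show ?thesis
    by (rule uniform_limit_theorem[rotated]) (auto intro!: always_eventually continuous_intros)
qed

lemma summable_cball:
  fixes c :: "nat \<Rightarrow> complex"
  assumes "summable (\<lambda>n. norm (c n))" "norm t \<le> 1"
  shows "summable (\<lambda>n. c n * t ^ n)"
proof (rule summable_comparison_test'[OF assms(1), of 0])
  show "norm (c n * t ^ n) \<le> norm (c n)" for n
    using assms(2) by (simp add: norm_mult norm_power power_le_one mult_left_le)
qed

section \<open>The dilogarithm and the logarithm\<close>

text \<open>The coefficients of the dilogarithm, indexed by the exponent of \<open>t\<close>: the constant term is
  \<open>1 / 0 = 0\<close>, as it should be.\<close>
lemma summable_inverse_squares: "summable (\<lambda>n. norm (1 / of_nat n ^ 2 :: complex))"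
  using inverse_power_summable[of 2, where 'a = real]
  by (simp add: norm_divide norm_power inverse_eq_divide)

lemma dilog_sums:
  assumes "norm t \<le> 1"
  shows "(\<lambda>n. t ^ Suc n / of_nat (Suc n) ^ 2) sums dilog t"
proof -
  have "summable (\<lambda>n. t ^ n / of_nat n ^ 2)"
    using summable_cball[OF summable_inverse_squares assms] by simp
  then have "summable (\<lambda>n. t ^ Suc n / of_nat (Suc n) ^ 2)"
    by (subst summable_Suc_iff)
  then show ?thesis
    unfolding dilog_def by (rule summable_sums)
qed

lemma dilog_eq_suminf:
  assumes "norm t \<le> 1"
  shows "dilog t = (\<Sum>n. 1 / of_nat n ^ 2 * t ^ n)"
proof -
  have "(\<lambda>n. t ^ n / of_nat n ^ 2) sums dilog t"
    using dilog_sums[OF assms] by (subst (asm) sums_Suc_iff) simp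
  then show ?thesis by (simp add: sums_iff)
qed

lemma continuous_on_dilog: "continuous_on (cball 0 1) dilog"
  using continuous_on_suminf_cball[OF summable_inverse_squares]
  by (rule continuous_on_eq) (simp add: dilog_eq_suminf)

lemma ln_sums:
  assumes "norm (t::complex) < 1"
  shows "(\<lambda>n. (-1) ^ n / of_nat (Suc n) * t ^ Suc n) sums ln (1 + t)"
proof -
  have "(\<lambda>n. (-1) ^ Suc n / of_nat n * t ^ n) sums ln (1 + t)"
    using Ln_series[OF assms] by simp
  then show ?thesis
    using sums_Suc_iff[of "\<lambda>n. (-1) ^ Suc n / of_nat n * t ^ n" "ln (1 + t)"] by simp
qed

text \<open>Differentiating termwise gives \<open>\<Sum> z\<^sup>n / (n + 1)\<close>, which is the logarithmic series
  for \<open>- log(1 - z)\<close> divided by \<open>z\<close>.\<close>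
lemma has_field_derivative_dilog:
  assumes "norm z < 1" "z \<noteq> 0"
  shows "(dilog has_field_derivative - ln (1 - z) / z) (at z)"
proof -
  let ?c = "\<lambda>n. 1 / of_nat n ^ 2 :: complex"
  have "summable (\<lambda>n. ?c n * 1 ^ n)"
    using summable_cball[OF summable_inverse_squares, of 1] by simp
  then have "((\<lambda>z. \<Sum>n. ?c n * z ^ n) has_field_derivative (\<Sum>n. diffs ?c n * z ^ n)) (at z)"
    by (rule termdiffs_strong) (use assms in simp)
  moreover have "(\<Sum>n. diffs ?c n * z ^ n) = - ln (1 - z) / z"
  proof -
    have "(\<lambda>n. (-1) ^ n / of_nat (Suc n) * (- z) ^ Suc n) sums ln (1 - z)"
      using ln_sums[of "- z"] assms by simp
    from sums_mult[OF this, of "- inverse z"]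
    have "(\<lambda>n. diffs ?c n * z ^ n) sums (- inverse z * ln (1 - z))"
    proof (rule back_subst[where P = "\<lambda>f. f sums _"], intro ext)
      fix n
      show "- inverse z * ((-1) ^ n / of_nat (Suc n) * (- z) ^ Suc n) = diffs ?c n * z ^ n"
        using assms(2)
        by (simp add: diffs_def power_minus[of z] power2_eq_square field_simps del: of_nat_Suc)
    qed
    then show ?thesis by (simp add: sums_iff field_simps)
  qed
  moreover have "eventually (\<lambda>z. z \<in> ball 0 1) (nhds z)"
    using assms by (intro eventually_nhds_in_open) auto
  then have "eventually (\<lambda>z. dilog z = (\<Sum>n. ?c n * z ^ n)) (nhds z)"
    by eventually_elim (simp add: dilog_eq_suminf)
  ultimately show ?thesis
    using DERIV_cong_ev by force
qed

section \<open>The generating function of the deviations\<close>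

lemma skew_dev_0 [simp]: "skew_dev 0 = - of_real (ln 2)"
  by (simp add: skew_dev_def)

lemma skew_dev_Suc: "skew_dev (Suc n) = skew_dev n + (-1) ^ n / of_nat (Suc n)"
  by (simp add: skew_dev_def skew_harm_Suc)

text \<open>The differences of the deviations are the coefficients of \<open>log(1 + t)\<close>, so summation by parts
  reduces the claim to the logarithmic series.\<close>
lemma skew_dev_sums:
  assumes "norm t < 1"
  shows "(\<lambda>n. skew_dev n * t ^ n) sums ((ln (1 + t) - of_real (ln 2)) / (1 - t))"
proof -
  \<comment> \<open>Summation by parts presupposes convergence, which boundedness of the coefficients gives.\<close>
  have "summable (\<lambda>n. skew_dev n * t ^ n)"
  proof (rule summable_comparison_test'[OF summable_geometric[of "norm t"], of 0])
    show "norm (skew_dev n * t ^ n) \<le> norm t ^ n" for n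
      using order.trans[OF norm_skew_dev_le[of n], of 1]
      by (simp add: norm_mult norm_power mult_left_le_one_le)
  qed (use assms in simp)
  then obtain S where S: "(\<lambda>n. skew_dev n * t ^ n) sums S"
    by (auto simp: summable_def)
  have "(\<lambda>n. (-1) ^ n / of_nat (Suc n) * t ^ Suc n) sums ((1 - t) * S + of_real (ln 2))"
    using sums_difference[OF S] by (simp add: skew_dev_Suc)
  then have "(1 - t) * S + of_real (ln 2) = ln (1 + t)"
    using ln_sums[OF assms] sums_unique2 by blast
  moreover have "t \<noteq> 1" using assms by auto
  ultimately have "S = (ln (1 + t) - of_real (ln 2)) / (1 - t)"
    by (simp add: field_simps)
  with S show ?thesis by simp
qed

section \<open>The cross terms\<close>

text \<open>Half of the mixed term in \<open>d\<^sub>n\<^sup>2 = (d\<^sub>n\<^sub>-\<^sub>1 + (-1)\<^sup>n\<^sup>-\<^sup>1 / n)\<^sup>2\<close>. For \<open>n = 0\<close> the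
  division by zero makes the coefficient \<open>0\<close>.\<close>
definition cross_coeff :: "nat \<Rightarrow> complex" where
  "cross_coeff n = (-1) ^ (n - 1) / of_nat n * skew_dev (n - 1)"

lemma cross_coeff_0 [simp]: "cross_coeff 0 = 0"
  by (simp add: cross_coeff_def)

lemma summable_cross_coeff: "summable (\<lambda>n. norm (cross_coeff n))"
proof (rule summable_comparison_test'[OF summable_inverse_squares, of 1])
  fix n :: nat
  assume "1 \<le> n"
  then obtain m where n: "n = Suc m" by (cases n) auto
  have "norm (cross_coeff n) = 1 / real (Suc m) * norm (skew_dev m)"
    by (simp add: n cross_coeff_def norm_mult norm_divide norm_power del: of_nat_Suc)
  also have "\<dots> \<le> 1 / real (Suc m) * (1 / real (Suc m))"
    by (intro mult_left_mono norm_skew_dev_le) simp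
  finally show "norm (norm (cross_coeff n)) \<le> norm (1 / of_nat n ^ 2 :: complex)"
    by (simp add: n norm_divide norm_mult power2_eq_square del: of_nat_Suc)
qed

lemma summable_skew_dev_squared: "summable (\<lambda>n. norm (skew_dev n ^ 2))"
proof -
  have "summable (\<lambda>n. norm (1 / of_nat (Suc n) ^ 2 :: complex))"
    using summable_inverse_squares by (subst summable_Suc_iff)
  then show ?thesis
  proof (rule summable_comparison_test'[of _ 0])
    show "norm (norm (skew_dev n ^ 2)) \<le> norm (1 / of_nat (Suc n) ^ 2 :: complex)" for n
      using power_mono[OF norm_skew_dev_le[of n], of 2]
      by (simp add: norm_power norm_divide power_divide del: of_nat_Suc)
  qed
qed

text \<open>Dividing by a positive real does not change the argument, so the principal branch splits.\<close>
lemma ln_halve: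
  assumes "norm (t::complex) < 1"
  shows "ln ((1 - t) / 2) = ln (1 - t) - of_real (ln 2)"
proof -
  have "1 - t \<noteq> 0" using assms by auto
  then show ?thesis using Ln_divide_of_real[of 2 "1 - t"] by simp
qed

lemma half_shift_in_cball: "norm (t::complex) \<le> 1 \<Longrightarrow> norm ((1 + t) / 2) \<le> 1"
  using norm_triangle_ineq[of 1 t] by (simp add: norm_divide)

text \<open>The two sides agree at \<open>0\<close> and have the same derivative \<open>log((1 - t)/2) / (1 + t)\<close>; it
  suffices that the sum of the series and \<open>Li\<^sub>2((1 + t)/2)\<close> has derivative zero on the disc.\<close>
lemma cross_series_ball:
  assumes "norm t < 1"
  shows "(\<Sum>n. cross_coeff n * t ^ n) = dilog (1 / 2) - dilog ((1 + t) / 2)"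
proof -
  define F where "F = (\<lambda>t. (\<Sum>n. cross_coeff n * t ^ n) + dilog ((1 + t) / 2))"
  have "(F has_field_derivative 0) (at t within ball 0 1)" if "t \<in> ball 0 1" for t
  proof -
    have t: "norm t < 1" using that by simp
    have cancel: "a / u + (- a / (u / 2)) * (1 / 2) = 0" for a u :: complex
      by simp
    have nz: "1 + t \<noteq> 0" using t by (metis add_eq_0_iff norm_minus_cancel norm_one less_irrefl)
    have "(\<lambda>n. skew_dev n * (- t) ^ n) sums ((ln (1 - t) - of_real (ln 2)) / (1 + t))"
      using skew_dev_sums[of "- t"] t by simp
    then have "(\<lambda>n. diffs cross_coeff n * t ^ n) sums ((ln (1 - t) - of_real (ln 2)) / (1 + t))"
      by (simp add: diffs_def cross_coeff_def power_minus[of t] mult_ac del: of_nat_Suc)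
    then have "(\<Sum>n. diffs cross_coeff n * t ^ n) = (ln (1 - t) - of_real (ln 2)) / (1 + t)"
      by (simp add: sums_iff)
    moreover have "((\<lambda>t. \<Sum>n. cross_coeff n * t ^ n) has_field_derivative
        (\<Sum>n. diffs cross_coeff n * t ^ n)) (at t)"
      by (rule termdiffs_strong[of _ 1])
        (use summable_cball[OF summable_cross_coeff, of 1] t in simp_all)
    moreover have "((\<lambda>t. dilog ((1 + t) / 2)) has_field_derivative
        (- ln (1 - (1 + t) / 2) / ((1 + t) / 2)) * (1 / 2)) (at t)"
    proof (rule DERIV_chain2[OF has_field_derivative_dilog])
      show "norm ((1 + t) / 2) < 1"
        using norm_triangle_ineq[of 1 t] t by (simp add: norm_divide)
      show "(1 + t) / 2 \<noteq> 0" using nz by simp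
      show "((\<lambda>t. (1 + t) / 2) has_field_derivative 1 / 2) (at t)"
        by (auto intro!: derivative_eq_intros)
    qed
    moreover have "1 - (1 + t) / 2 = (1 - t) / 2"
      by (simp add: field_simps)
    ultimately have "(F has_field_derivative (ln (1 - t) - of_real (ln 2)) / (1 + t)
        + (- (ln (1 - t) - of_real (ln 2)) / ((1 + t) / 2)) * (1 / 2)) (at t)"
      unfolding F_def using DERIV_add ln_halve[OF t] by fastforce
    moreover have "(ln (1 - t) - of_real (ln 2)) / (1 + t)
        + (- (ln (1 - t) - of_real (ln 2)) / ((1 + t) / 2)) * (1 / 2) = 0"
      by (rule cancel)
    ultimately show ?thesis
      using has_field_derivative_at_within by force
  qed
  then obtain c where "F t = c" if "t \<in> ball 0 1" for t
    using has_field_derivative_zero_constant[OF convex_ball, of 0 1 F] by blast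
  then have "F t = F 0" using assms by simp
  then show ?thesis by (simp add: F_def algebra_simps)
qed

text \<open>Both sides are continuous on the closed disc, the right-hand side because \<open>(1 + t)/2\<close> stays
  in the closed disc, so the identity extends from the open disc to its closure.\<close>
lemma cross_series_cball:
  assumes "norm t \<le> 1"
  shows "(\<Sum>n. cross_coeff n * t ^ n) = dilog (1 / 2) - dilog ((1 + t) / 2)"
proof -
  let ?h = "\<lambda>t. (\<Sum>n. cross_coeff n * t ^ n) - (dilog (1 / 2) - dilog ((1 + t) / 2))"
  have "continuous_on (cball 0 1) (\<lambda>t. dilog ((1 + t) / 2))"
  proof (rule continuous_on_compose2[OF continuous_on_dilog])
    show "continuous_on (cball 0 1) (\<lambda>t::complex. (1 + t) / 2)"
      by (intro continuous_intros) simp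
    show "(\<lambda>t::complex. (1 + t) / 2) ` cball 0 1 \<subseteq> cball 0 1"
      unfolding image_subset_iff using half_shift_in_cball by (metis mem_cball_0)
  qed
  then have "continuous_on (closure (ball 0 1)) ?h"
    by (auto intro!: continuous_intros continuous_on_suminf_cball summable_cross_coeff)
  then have "?h t = 0"
    by (rule continuous_constant_on_closure) (use assms in \<open>auto simp: cross_series_ball\<close>)
  then show ?thesis by simp
qed

section \<open>The generating functions of the squares\<close>

text \<open>The hypothesis \<open>t \<noteq> 1\<close> is what allows dividing by \<open>1 - t\<close> after the summation by parts, which
  splits the differences of the squares into dilogarithm and cross terms.\<close>
lemma skew_dev_squared_sums:
  assumes "norm t \<le> 1" "t \<noteq> 1"
  shows "(\<lambda>n. skew_dev n ^ 2 * t ^ n) sums (1 / (1 - t) *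
    (dilog t + of_real (ln 2) ^ 2 - 2 * (dilog ((1 + t) / 2) - dilog (1 / 2))))"
proof -
  obtain S where S: "(\<lambda>n. skew_dev n ^ 2 * t ^ n) sums S"
    using summable_cball[OF summable_skew_dev_squared assms(1)] by (auto simp: summable_def)
  have "(\<lambda>n. cross_coeff n * t ^ n) sums (dilog (1 / 2) - dilog ((1 + t) / 2))"
    using summable_cball[OF summable_cross_coeff assms(1)] cross_series_cball[OF assms(1)]
    by (simp add: sums_iff)
  then have "(\<lambda>n. cross_coeff (Suc n) * t ^ Suc n) sums (dilog (1 / 2) - dilog ((1 + t) / 2))"
    by (subst sums_Suc_iff) simp
  from sums_add[OF dilog_sums[OF assms(1)] sums_mult[OF this, of 2]]
  have "(\<lambda>n. (skew_dev (Suc n) ^ 2 - skew_dev n ^ 2) * t ^ Suc n) sums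
      (dilog t + 2 * (dilog (1 / 2) - dilog ((1 + t) / 2)))"
  proof (rule back_subst[where P = "\<lambda>f. f sums _"], intro ext)
    fix n
    have "((-1) ^ n / of_nat (Suc n) :: complex) ^ 2 = 1 / of_nat (Suc n) ^ 2"
      by (simp add: power_divide flip: power_mult del: of_nat_Suc)
    then have "skew_dev (Suc n) ^ 2 - skew_dev n ^ 2 = 1 / of_nat (Suc n) ^ 2 + 2 * cross_coeff (Suc n)"
      by (simp add: skew_dev_Suc cross_coeff_def power2_sum algebra_simps del: of_nat_Suc)
    then show "t ^ Suc n / of_nat (Suc n) ^ 2 + 2 * (cross_coeff (Suc n) * t ^ Suc n)
        = (skew_dev (Suc n) ^ 2 - skew_dev n ^ 2) * t ^ Suc n"
      by (simp only: distrib_right times_divide_eq_left mult_1 mult.assoc)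
  qed
  then have "(1 - t) * S - skew_dev 0 ^ 2 = dilog t + 2 * (dilog (1 / 2) - dilog ((1 + t) / 2))"
    using sums_difference[OF S] sums_unique2 by blast
  then have "S = 1 / (1 - t) *
      (dilog t + of_real (ln 2) ^ 2 - 2 * (dilog ((1 + t) / 2) - dilog (1 / 2)))"
    using assms(2) by (simp add: field_simps)
  with S show ?thesis by simp
qed

text \<open>With \<open>l = log 2\<close>, expanding \<open>(d\<^sub>n + l)\<^sup>2\<close> adds to the series of squares \<open>2 l\<close> times the
  generating function of the deviations and \<open>l\<^sup>2\<close> times a geometric series; the terms in \<open>l\<^sup>2\<close>
  cancel.\<close>
lemma skew_harm_squared_sums:
  assumes "norm t < 1"
  shows "(\<lambda>n. of_real (skew_harm n) ^ 2 * t ^ n) sums (1 / (1 - t) *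
    (dilog t + 2 * of_real (ln 2) * ln (1 + t) + 2 * dilog (1 / 2) - 2 * dilog ((1 + t) / 2)))"
proof -
  let ?l = "of_real (ln 2) :: complex"
  have t: "norm t \<le> 1" "t \<noteq> 1" using assms by auto
  have "of_real (skew_harm n) ^ 2 * t ^ n
      = skew_dev n ^ 2 * t ^ n + 2 * ?l * (skew_dev n * t ^ n) + ?l ^ 2 * t ^ n" for n
    by (simp add: skew_dev_def power2_eq_square algebra_simps)
  moreover have "1 / (1 - t) *
        (dilog t + ?l ^ 2 - 2 * (dilog ((1 + t) / 2) - dilog (1 / 2)))
      + 2 * ?l * ((ln (1 + t) - ?l) / (1 - t)) + ?l ^ 2 * (1 / (1 - t))
      = 1 / (1 - t) *
        (dilog t + 2 * ?l * ln (1 + t) + 2 * dilog (1 / 2) - 2 * dilog ((1 + t) / 2))"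
    using t(2) by (simp add: divide_simps) (simp add: algebra_simps power2_eq_square)
  moreover note sums_add[OF sums_add[OF skew_dev_squared_sums[OF t]
      sums_mult[OF skew_dev_sums[OF assms], of "2 * ?l"]]
      sums_mult[OF geometric_sums[OF assms], of "?l ^ 2"]]
  ultimately show ?thesis by simp
qed

theorem proposition5:
  shows "(\<forall>t::complex. norm t < 1 \<longrightarrow>
      (\<lambda>n. of_real (skew_harm (Suc n)) ^ 2 * t ^ Suc n) sums
        (1 / (1 - t) *
          (dilog t + 2 * of_real (ln 2) * ln (1 + t) + 2 * dilog (1 / 2)
            - 2 * dilog ((1 + t) / 2))))
    \<and> (\<forall>t::complex. norm t \<le> 1 \<and> t \<noteq> 1 \<longrightarrow>
      (\<lambda>n. of_real (skew_harm n - ln 2) ^ 2 * t ^ n) sums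
        (1 / (1 - t) *
          (dilog t + of_real (ln 2) ^ 2 - 2 * (dilog ((1 + t) / 2) - dilog (1 / 2)))))
    \<and> (\<exists>L::complex.
      ((\<lambda>t. 1 / (1 - t) *
          (dilog t + of_real (ln 2) ^ 2 - 2 * (dilog ((1 + t) / 2) - dilog (1 / 2))))
        \<longlongrightarrow> L) (at 1 within cball 0 1) \<and>
      (\<lambda>n. of_real (skew_harm n - ln 2) ^ 2 * (1::complex) ^ n) sums L)"
proof (intro conjI allI impI, goal_cases)
  case (1 t)
  \<comment> \<open>The term with index \<open>0\<close> vanishes, so the series may start at \<open>1\<close>.\<close>
  from skew_harm_squared_sums[OF this] show ?case
    by (subst sums_Suc_iff) simp
next
  case (2 t)
  then show ?case
    using skew_dev_squared_sums[of t] by (simp add: skew_dev_def)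
next
  case 3
  let ?R = "\<lambda>t. 1 / (1 - t) *
    (dilog t + of_real (ln 2) ^ 2 - 2 * (dilog ((1 + t) / 2) - dilog (1 / 2)))"
  let ?S = "\<lambda>t. \<Sum>n. skew_dev n ^ 2 * t ^ n"
  have "(?S \<longlongrightarrow> ?S 1) (at 1 within cball 0 1)"
    using continuous_on_suminf_cball[OF summable_skew_dev_squared]
    unfolding continuous_on_def by (rule bspec) simp
  \<comment> \<open>The filter \<open>at 1\<close> leaves out the point \<open>1\<close>, where \<open>?R\<close> divides by zero.\<close>
  moreover have "eventually (\<lambda>t. ?S t = ?R t) (at 1 within cball 0 1)"
    using skew_dev_squared_sums by (auto simp: eventually_at_filter sums_iff)
  ultimately have "(?R \<longlongrightarrow> ?S 1) (at 1 within cball 0 1)"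
    by (rule Lim_transform_eventually)
  moreover have "(\<lambda>n. skew_dev n ^ 2 * 1 ^ n) sums ?S 1"
    using summable_cball[OF summable_skew_dev_squared, of 1] by (intro summable_sums) simp
  ultimately show ?case
    unfolding skew_dev_def by blast
qed

end
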